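(* Let $F:\mathbb{N}\to\mathbb{C}$ be such that all Wintner coefficients $\mathrm{Win}_qF$ exist, and assume that for every $d\in\mathbb{N}$, $\lim_P\mathrm{Irr}^{(P)}_dF=0$. If the set $\{q\in\mathbb{N}:\mathrm{Win}_qF\ne0\}$ is finite, then there exists $Q\in\mathbb{N}$ such that $$F(a)=\sum_{q\le Q}(\mathrm{Win}_qF)c_q(a)\qquad\text{for all }a\in\mathbb{N}.$$
   Context: $F'=F*\mu$; $\mathrm{Win}_qF=\sum_{d\equiv0\bmod q}F'(d)/d$ (convergent series). For a prime $P$, $)P($ is the set of $n\in\mathbb{N}$ with no prime factor $\le P$, and $\mathrm{Irr}^{(P)}_dF=\lim_{x\to\infty}\sum_{r\in)P(,\,1<r\le x}F'(dr)/r$. $c_q(a)$ is the Ramanujan sum; $\lim_P$ is the limit as $P\to\infty$ through primes. *)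

theory Defs
  imports Complex_Main "HOL-Computational_Algebra.Computational_Algebra" "HOL-Number_Theory.Cong"
begin

text \<open>
  The positive integers are represented in type \<^typ>\<open>nat\<close>; the value of an arithmetic function
  at 0 is never used.
\<close>

definition moebius :: "nat \<Rightarrow> int" where
  "moebius n = (if squarefree n then (-1) ^ card (prime_factors n) else 0)"

definition dirichlet_conv :: "(nat \<Rightarrow> complex) \<Rightarrow> (nat \<Rightarrow> complex) \<Rightarrow> nat \<Rightarrow> complex" where
  "dirichlet_conv f g n = (\<Sum>t | t dvd n. f t * g (n div t))"

text \<open>The Eratosthenes transform \<open>F' = F * \<mu>\<close>.\<close>

definition eratosthenes :: "(nat \<Rightarrow> complex) \<Rightarrow> nat \<Rightarrow> complex" where
  "eratosthenes F = dirichlet_conv F (\<lambda>n. of_int (moebius n))"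

text \<open>
  The Wintner series need not converge absolutely, so it is summed in increasing order of \<open>d\<close>.
\<close>

definition wintner_partial :: "nat \<Rightarrow> (nat \<Rightarrow> complex) \<Rightarrow> nat \<Rightarrow> complex" where
  "wintner_partial q F x = (\<Sum>d | d \<in> {1..x} \<and> [d = 0] (mod q). eratosthenes F d / of_nat d)"

definition Win_exists :: "nat \<Rightarrow> (nat \<Rightarrow> complex) \<Rightarrow> bool" where
  "Win_exists q F \<longleftrightarrow> convergent (wintner_partial q F)"

definition Win :: "nat \<Rightarrow> (nat \<Rightarrow> complex) \<Rightarrow> complex" where
  "Win q F = lim (wintner_partial q F)"

text \<open>The set \<open>)P(\<close>.\<close>

definition sifted :: "nat \<Rightarrow> nat set" where
  "sifted P = {n. n \<ge> 1 \<and> \<not> (\<exists>p. prime p \<and> p dvd n \<and> p \<le> P)}"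

text \<open>
  If all Wintner coefficients of \<open>F\<close> exist, then so does the limit below, for all primes \<open>P\<close> and
  all \<open>d \<ge> 1\<close>: by inclusion-exclusion over the squarefree \<open>t\<close> composed of primes \<open>\<le> P\<close>, the
  partial sum, with the term \<open>r = 1\<close> included, is a finite combination of the terms
  \<open>\<mu>(t) * d\<close> times the Wintner partial sum for the modulus \<open>d * t\<close> up to \<open>d * x\<close>.
\<close>

definition Irr :: "nat \<Rightarrow> nat \<Rightarrow> (nat \<Rightarrow> complex) \<Rightarrow> complex" where
  "Irr P d F = lim (\<lambda>x::nat. \<Sum>r | r \<in> sifted P \<and> 1 < r \<and> r \<le> x.
                      eratosthenes F (d * r) / of_nat r)"

definition ramanujan_sum :: "nat \<Rightarrow> nat \<Rightarrow> complex" where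
  "ramanujan_sum q a =
     (\<Sum>j | j \<in> {1..q} \<and> coprime j q. exp (2 * of_real pi * \<i> * of_nat j * of_nat a / of_nat q))"

text \<open>The filter for limits as \<open>P\<close> tends to infinity through primes.\<close>

definition primes_at_top :: "nat filter" where
  "primes_at_top = inf at_top (principal {p. prime p})"

end

theory Submission
  imports Defs
begin

text \<open>
  Inclusion-exclusion over the divisors \<open>t\<close> of \<open>P!\<close> expresses the condition \<open>r \<in> )P(\<close> and gives
  \<open>F'(d) + Irr\<^sub>P\<^sub>,\<^sub>d F = d \<Sum>\<^bsub>t | P!\<^esub> \<mu>(t) Win\<^bsub>d t\<^esub> F\<close>. If only finitely many Wintner coefficients are
  nonzero, all of them with index at most \<open>B\<close>, the right-hand side is constant for \<open>P \<ge> B\<close>, so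
  letting \<open>P \<rightarrow> \<infinity>\<close> yields \<open>F'(d) = d \<Sum>\<^bsub>q \<le> B, d | q\<^esub> \<mu>(q/d) Win\<^sub>q F\<close>. Summing over \<open>d | a\<close> and
  exchanging the sums gives the expansion, by Kluyver's formula
  \<open>c\<^sub>q(a) = \<Sum>\<^bsub>d | gcd(a, q)\<^esub> d \<mu>(q/d)\<close>.
\<close>

section \<open>Moebius function and Moebius inversion\<close>

lemma moebius_prime_mult:
  assumes "prime p" "\<not> p dvd n" "n > 0"
  shows "moebius (p * n) = - moebius n"
proof -
  have cop: "coprime p n"
    using assms by (simp add: prime_imp_coprime)
  have "squarefree (p * n) \<longleftrightarrow> squarefree n"
    using assms cop by (auto simp: squarefree_mult_coprime squarefree_prime dest: squarefree_multD)
  moreover have "prime_factors (p * n) = insert p (prime_factors n)"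
    using assms by (subst prime_factors_product) (auto simp: prime_prime_factors)
  moreover have "p \<notin> prime_factors n"
    using assms by auto
  ultimately show ?thesis
    by (simp add: moebius_def)
qed

text \<open>For n > 1 fix a prime p dividing n. Each divisor t in \<open>A\<close> is prime to p and
  cancels against p * t. The divisors outside \<open>A\<close> and p * \<open>A\<close> are
  multiples of p^2, where \<open>moebius\<close> vanishes.\<close>

lemma sum_moebius_divisors:
  assumes "n > 0"
  shows "(\<Sum>t | t dvd n. moebius t) = (if n = 1 then 1 else 0)"
proof (cases "n = 1")
  case True
  then show ?thesis by (simp add: moebius_def)
next
  case False
  then obtain p where p: "prime p" "p dvd n"
    using prime_factor_nat by blast
  define A where "A = {t. t dvd n \<and> \<not> p dvd t \<and> p * t dvd n}"
  have "finite {t. t dvd n}"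
    using assms by simp
  then have finA: "finite A"
    unfolding A_def by (rule rev_finite_subset) auto
  have zero: "moebius t = 0" if t: "t dvd n" "t \<notin> A \<union> (*) p ` A" for t
  proof -
    have "p dvd t"
    proof (rule ccontr)
      assume np: "\<not> p dvd t"
      then have "coprime p t"
        using p by (simp add: prime_imp_coprime)
      then have "p * t dvd n"
        using p t by (simp add: divides_mult)
      then show False
        using t np by (simp add: A_def)
    qed
    then obtain s where s: "t = p * s" ..
    have "s dvd n"
      using t s dvd_mult_right by blast
    then have "p dvd s"
      using t s by (auto simp: A_def)
    then have "p\<^sup>2 dvd t"
      using s by (auto simp: power2_eq_square)
    then have "\<not> squarefree t"
      using p by (auto simp: squarefree_def)
    then show ?thesis
      by (simp add: moebius_def)
  qed
  have "(\<Sum>t | t dvd n. moebius t) = (\<Sum>t \<in> A \<union> (*) p ` A. moebius t)"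
    using assms zero by (intro sum.mono_neutral_right) (auto simp: A_def)
  also have "\<dots> = (\<Sum>t\<in>A. moebius t) + (\<Sum>t\<in>(*) p ` A. moebius t)"
    using finA by (intro sum.union_disjoint) (auto simp: A_def)
  also have "(\<Sum>t\<in>(*) p ` A. moebius t) = (\<Sum>t\<in>A. moebius (p * t))"
    using p by (subst sum.reindex) (auto simp: inj_on_def)
  also have "\<dots> = (\<Sum>t\<in>A. - moebius t)"
    using p assms by (intro sum.cong refl moebius_prime_mult) (auto simp: A_def intro: Nat.gr0I)
  finally show ?thesis
    using False by (simp add: sum_negf)
qed

lemma sum_moebius_divisors_complex:
  assumes "n > 0"
  shows "(\<Sum>t | t dvd n. of_int (moebius t)) = (if n = 1 then 1 else 0 :: complex)"
  using arg_cong[OF sum_moebius_divisors[OF assms], where f = "of_int :: int \<Rightarrow> complex"]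
  by simp

text \<open>The surviving t are the divisors of gcd n N. Since the range of t depends on N alone, a
  coprimality condition on a summation variable n becomes a sum that can be exchanged with the outer
  one. It is applied with N = q for Ramanujan sums and with N = P! for sifted sums.\<close>

lemma sum_moebius_coprime:
  assumes "N > 0"
  shows "(\<Sum>t | t dvd N. if t dvd n then of_int (moebius t) else 0) =
    (if coprime n N then 1 else 0 :: complex)"
proof -
  have "(\<Sum>t | t dvd N. if t dvd n then of_int (moebius t) else 0 :: complex) =
      (\<Sum>t \<in> {t. t dvd N} \<inter> {t. t dvd n}. of_int (moebius t))"
    using assms by (subst sum.If_cases) auto
  also have "{t. t dvd N} \<inter> {t. t dvd n} = {t. t dvd gcd n N}"
    by auto
  also have "(\<Sum>t\<in>\<dots>. of_int (moebius t)) = (if gcd n N = 1 then 1 else 0 :: complex)"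
    using assms by (intro sum_moebius_divisors_complex) simp
  finally show ?thesis
    by (simp add: coprime_iff_gcd_eq_1)
qed

lemma bij_betw_dvd_multiples:
  assumes "(d::nat) > 0" "t > 0"
  shows "bij_betw ((*) d) {r \<in> {1..x}. t dvd r} {m \<in> {1..d * x}. d * t dvd m}"
  unfolding bij_betw_def
proof
  show "inj_on ((*) d) {r \<in> {1..x}. t dvd r}"
    using assms by (auto simp: inj_on_def)
  show "(*) d ` {r \<in> {1..x}. t dvd r} = {m \<in> {1..d * x}. d * t dvd m}"
  proof (intro equalityI subsetI)
    fix m assume "m \<in> {m \<in> {1..d * x}. d * t dvd m}"
    then obtain k where "m = d * (t * k)" "1 \<le> m" "m \<le> d * x"
      by (auto elim!: dvdE simp: mult.assoc)
    then show "m \<in> (*) d ` {r \<in> {1..x}. t dvd r}"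
      using assms by (intro image_eqI[of _ _ "t * k"]) auto
  qed (use assms in auto)
qed

text \<open>Moebius inversion: after exchanging the sums, d = t * s with s dividing a / t, and the
  sum of \<open>moebius s\<close> over these s leaves only t = a.\<close>

lemma sum_eratosthenes_divisors:
  assumes "a > 0"
  shows "(\<Sum>d | d dvd a. eratosthenes F d) = F a"
proof -
  have fin: "finite {d. d dvd a}"
    using assms by simp
  have "(\<Sum>d | d dvd a. eratosthenes F d) =
      (\<Sum>d | d dvd a. \<Sum>t | t dvd a. if t dvd d then F t * of_int (moebius (d div t)) else 0)"
  proof (intro sum.cong refl)
    fix d assume d: "d \<in> {d. d dvd a}"
    have "{t. t dvd a} \<inter> {t. t dvd d} = {t. t dvd d}"
      using d by (auto intro: dvd_trans)
    then show "eratosthenes F d =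
        (\<Sum>t | t dvd a. if t dvd d then F t * of_int (moebius (d div t)) else 0)"
      using fin by (simp add: eratosthenes_def dirichlet_conv_def sum.If_cases)
  qed
  also have "\<dots> = (\<Sum>t | t dvd a. \<Sum>d | d dvd a.
      if t dvd d then F t * of_int (moebius (d div t)) else 0)"
    by (rule sum.swap)
  also have "\<dots> = (\<Sum>t | t dvd a. if t = a then F t else 0)"
  proof (intro sum.cong refl)
    fix t assume "t \<in> {t. t dvd a}"
    then obtain k where k: "a = t * k" by auto
    then have pos: "t > 0" "k > 0"
      using assms by auto
    have "bij_betw ((*) t) {s. s dvd k} ({d. d dvd a} \<inter> {d. t dvd d})"
      using pos k by (auto simp: bij_betw_def inj_on_def image_iff elim!: dvdE[of t])
    then have "(\<Sum>d \<in> {d. d dvd a} \<inter> {d. t dvd d}. F t * of_int (moebius (d div t))) =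
        (\<Sum>s | s dvd k. F t * of_int (moebius (t * s div t)))"
      by (rule sum.reindex_bij_betw[symmetric])
    also have "\<dots> = F t * (if k = 1 then 1 else 0)"
      using pos by (simp add: sum_moebius_divisors_complex flip: sum_distrib_left)
    finally show "(\<Sum>d | d dvd a. if t dvd d then F t * of_int (moebius (d div t)) else 0) =
        (if t = a then F t else 0)"
      using fin pos k by (simp add: sum.If_cases)
  qed
  also have "\<dots> = F a"
    using fin by (simp add: sum.delta)
  finally show ?thesis .
qed

section \<open>Ramanujan sums and Kluyver's formula\<close>

lemma sum_unit_roots:
  assumes "n > 0"
  shows "(\<Sum>k=1..n. exp (2 * of_real pi * \<i> * of_nat k * of_nat a / of_nat n)) =
    (if n dvd a then of_nat n else 0 :: complex)"
proof -
  define w :: complex where "w = exp (2 * of_real pi * \<i> * of_nat a / of_nat n)"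
  have pow: "exp (2 * of_real pi * \<i> * of_nat k * of_nat a / of_nat n) = w ^ k" for k :: nat
    by (simp add: w_def exp_of_nat_mult[symmetric] mult_ac)
  have w_cis: "w = cis (2 * pi * real a / real n)"
    by (simp add: w_def cis_conv_exp mult_ac)
  have "w ^ n = cis (2 * pi * real a)"
    using assms by (simp add: w_cis DeMoivre)
  then have wn: "w ^ n = 1"
    by (simp add: cis_multiple_2pi)
  have w1: "w = 1 \<longleftrightarrow> n dvd a"
  proof -
    have "w = 1 \<longleftrightarrow> (\<exists>m::int. 2 * pi * real a / real n = of_int (2 * m) * pi)"
    proof -
      \<comment> \<open>A point of the unit circle is 1 as soon as its real part is 1, so the
        periodicity of the cosine decides when w = 1.\<close>
      have "cis x = 1 \<longleftrightarrow> cos x = 1" for x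
        by (auto simp: complex_eq_iff cos_one_sin_zero)
      then show ?thesis
        by (simp add: w_cis cos_one_2pi_int mult_ac)
    qed
    also have "\<dots> \<longleftrightarrow> (\<exists>m::int. real_of_int (int a) = real_of_int (m * int n))"
      using assms by (simp add: field_simps)
    also have "\<dots> \<longleftrightarrow> int n dvd int a"
      unfolding of_int_eq_iff by (auto simp: dvd_def mult.commute)
    finally show ?thesis by simp
  qed
  have "(\<Sum>k=1..n. w ^ k) = (if n dvd a then of_nat n else 0)"
  proof (cases "w = 1")
    case True
    then show ?thesis using w1 by simp
  next
    case False
    \<comment> \<open>Pulling out one factor w shifts the range to 0..n-1; the geometric sum then
      vanishes because w^n = 1.\<close>
    have "(\<Sum>k=1..n. w ^ k) = w * (\<Sum>k<n. w ^ k)"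
      by (simp add: sum_distrib_left sum.atLeast1_atMost_eq)
    then show ?thesis
      using False w1 wn by (simp add: geometric_sum)
  qed
  then show ?thesis
    by (simp add: pow)
qed

text \<open>Moebius detection of coprimality lets j run over the multiples j = t * i of each divisor
  t of q. What remains is a complete sum over the roots of unity of order dividing q / t, evaluated
  by \<open>sum_unit_roots\<close>.\<close>

lemma ramanujan_sum_kluyver:
  assumes "q > 0"
  shows "ramanujan_sum q a =
    (\<Sum>d | d dvd q. if d dvd a then of_nat d * of_int (moebius (q div d)) else 0)"
proof -
  define e :: "nat \<Rightarrow> complex" where
    "e j = exp (2 * of_real pi * \<i> * of_nat j * of_nat a / of_nat q)" for j
  have "ramanujan_sum q a = (\<Sum>j=1..q. if coprime j q then e j else 0)"
    by (simp add: ramanujan_sum_def e_def sum.If_cases Int_def)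
  also have "\<dots> = (\<Sum>j=1..q. (if coprime j q then 1 else 0) * e j)"
    by (intro sum.cong) auto
  also have "\<dots> = (\<Sum>j=1..q. \<Sum>t | t dvd q. if t dvd j then of_int (moebius t) * e j else 0)"
    by (subst sum_moebius_coprime[OF assms, symmetric])
      (auto simp: sum_distrib_right intro!: sum.cong)
  also have "\<dots> = (\<Sum>t | t dvd q. \<Sum>j=1..q. if t dvd j then of_int (moebius t) * e j else 0)"
    by (rule sum.swap)
  also have "\<dots> = (\<Sum>t | t dvd q. of_int (moebius t) *
      (if q div t dvd a then of_nat (q div t) else 0))"
  proof (intro sum.cong refl)
    fix t assume "t \<in> {t. t dvd q}"
    then obtain k where k: "q = t * k" by auto
    then have pos: "t > 0" "k > 0"
      using assms by auto
    \<comment> \<open>The factor 1 in \<open>t * 1 dvd j\<close> brings the range into the shape of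
      \<open>bij_betw_dvd_multiples\<close>.\<close>
    have "(\<Sum>j=1..q. if t dvd j then of_int (moebius t) * e j else 0) =
        (\<Sum>j \<in> {j \<in> {1..t * k}. t * 1 dvd j}. of_int (moebius t) * e j)"
      by (simp add: sum.If_cases Int_def k)
    also have "\<dots> = (\<Sum>i \<in> {i \<in> {1..k}. 1 dvd i}. of_int (moebius t) * e (t * i))"
      using pos by (intro sum.reindex_bij_betw[symmetric] bij_betw_dvd_multiples) auto
    also have "\<dots> = (\<Sum>i=1..k. of_int (moebius t) * e (t * i))"
      by (intro sum.cong) auto
    also have "\<dots> = of_int (moebius t) *
        (\<Sum>i=1..k. exp (2 * of_real pi * \<i> * of_nat i * of_nat a / of_nat k))"
      using pos by (simp add: e_def k sum_distrib_left field_simps)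
    also have "\<dots> = of_int (moebius t) * (if k dvd a then of_nat k else 0)"
      using pos by (simp only: sum_unit_roots)
    finally show "(\<Sum>j=1..q. if t dvd j then of_int (moebius t) * e j else 0) =
        of_int (moebius t) * (if q div t dvd a then of_nat (q div t) else 0)"
      using pos k by simp
  qed
  \<comment> \<open>Pass to the complementary divisor d = q / t.\<close>
  also have "\<dots> = (\<Sum>d | d dvd q. if d dvd a then of_nat d * of_int (moebius (q div d)) else 0)"
  proof (rule sum.reindex_bij_witness[of _ "\<lambda>d. q div d" "\<lambda>d. q div d"])
    fix d assume d: "d \<in> {d. d dvd q}"
    have qq: "q div (q div d) = d"
      using d assms by auto
    then show "q div (q div d) = d" .
    show "q div d \<in> {d. d dvd q}"
      using d by auto
    show "(if q div d dvd a then of_nat (q div d) * of_int (moebius (q div (q div d))) else 0) =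
        of_int (moebius d) * (if q div d dvd a then of_nat (q div d) else 0 :: complex)"
      by (simp add: qq)
  qed (use assms in auto)
  finally show ?thesis .
qed

section \<open>Irregular sums in terms of Wintner coefficients\<close>

lemma sifted_iff_coprime_fact: "r \<in> sifted P \<longleftrightarrow> r \<ge> 1 \<and> coprime r (fact P)"
proof -
  have "coprime r N \<longleftrightarrow> \<not> (\<exists>p. prime p \<and> p dvd r \<and> p dvd N)" for N :: nat
  proof
    assume "coprime r N"
    then show "\<not> (\<exists>p. prime p \<and> p dvd r \<and> p dvd N)"
      using coprime_common_divisor_nat not_prime_1 by metis
  next
    assume *: "\<not> (\<exists>p. prime p \<and> p dvd r \<and> p dvd N)"
    then show "coprime r N"
      using prime_factor_nat[of "gcd r N"] unfolding coprime_iff_gcd_eq_1 by auto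
  qed
  then show ?thesis
    by (auto simp: sifted_def prime_dvd_fact_iff)
qed

text \<open>Being sifted means being coprime to P!, so Moebius detection turns the sifted sum into
  finitely many sums over multiples of t. With m = d * r the term F'(d r) / r equals d F'(m) / m,
  which produces Wintner partial sums of modulus d * t. The subtracted term is r = 1. The proof also
  shows that the limit defining \<open>Irr\<close> exists.\<close>

lemma Irr_eq_Win_sum:
  assumes "\<forall>q\<ge>1. Win_exists q F" "d \<ge> 1"
  shows "Irr P d F =
    (\<Sum>t | t dvd fact P. of_nat d * of_int (moebius t) * Win (d * t) F) - eratosthenes F d"
proof -
  let ?f = "eratosthenes F"
  have pos: "t > 0" if "t dvd fact P" for t :: nat
    using that by (auto intro: Nat.gr0I)
  have partial: "(\<Sum>r | r \<in> sifted P \<and> 1 < r \<and> r \<le> x. ?f (d * r) / of_nat r) =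
      (\<Sum>t | t dvd fact P. of_nat d * of_int (moebius t) * wintner_partial (d * t) F (d * x)) - ?f d"
    if "x \<ge> 1" for x
  proof -
    \<comment> \<open>For x = 0 the term r = 1 would be missing, so the identity is only claimed
      from x = 1 on; this suffices for the limit.\<close>
    have "{r. r \<in> sifted P \<and> 1 \<le> r \<and> r \<le> x} = insert 1 {r. r \<in> sifted P \<and> 1 < r \<and> r \<le> x}"
      using that by (auto simp: sifted_iff_coprime_fact)
    then have "(\<Sum>r | r \<in> sifted P \<and> 1 < r \<and> r \<le> x. ?f (d * r) / of_nat r) + ?f d =
        (\<Sum>r | r \<in> sifted P \<and> 1 \<le> r \<and> r \<le> x. ?f (d * r) / of_nat r)"
      by simp
    also have "\<dots> = (\<Sum>r=1..x. (if coprime r (fact P) then 1 else 0) * (?f (d * r) / of_nat r))"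
      by (intro sum.mono_neutral_cong_left) (auto simp: sifted_iff_coprime_fact)
    also have "\<dots> = (\<Sum>r=1..x. \<Sum>t | t dvd fact P.
        if t dvd r then of_int (moebius t) * (?f (d * r) / of_nat r) else 0)"
      by (subst sum_moebius_coprime[symmetric])
        (auto simp: sum_distrib_right simp del: times_divide_eq_right intro!: sum.cong)
    also have "\<dots> = (\<Sum>t | t dvd fact P. \<Sum>r=1..x.
        if t dvd r then of_int (moebius t) * (?f (d * r) / of_nat r) else 0)"
      by (rule sum.swap)
    also have "\<dots> = (\<Sum>t | t dvd fact P.
        of_nat d * of_int (moebius t) * wintner_partial (d * t) F (d * x))"
    proof (intro sum.cong refl)
      fix t :: nat assume "t \<in> {t. t dvd fact P}"
      then have t: "t > 0" using pos by auto
      have "wintner_partial (d * t) F (d * x) =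
          (\<Sum>m \<in> {m \<in> {1..d * x}. d * t dvd m}. ?f m / of_nat m)"
        by (simp add: wintner_partial_def cong_0_iff)
      also have "\<dots> = (\<Sum>r \<in> {r \<in> {1..x}. t dvd r}. ?f (d * r) / of_nat (d * r))"
        using t assms
        by (intro sum.reindex_bij_betw[symmetric] bij_betw_dvd_multiples) auto
      finally show "(\<Sum>r=1..x. if t dvd r then of_int (moebius t) * (?f (d * r) / of_nat r) else 0) =
          of_nat d * of_int (moebius t) * wintner_partial (d * t) F (d * x)"
        using assms by (simp add: sum.If_cases Int_def sum_distrib_left)
    qed
    finally show ?thesis by (simp add: eq_diff_eq)
  qed
  have lim: "(\<lambda>x. wintner_partial (d * t) F (d * x)) \<longlonglongrightarrow> Win (d * t) F" if "t dvd fact P" for t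
  proof -
    have "wintner_partial (d * t) F \<longlonglongrightarrow> Win (d * t) F"
      using assms pos[OF that] by (simp add: Win_def Win_exists_def convergent_LIMSEQ_iff)
    \<comment> \<open>The cutoffs d * x form a subsequence, along which the Wintner partial sums
      keep their limit.\<close>
    moreover have "strict_mono ((*) d)"
      using assms by (auto simp: strict_mono_def)
    ultimately show ?thesis
      using LIMSEQ_subseq_LIMSEQ by (force simp: o_def)
  qed
  have "(\<lambda>x. (\<Sum>t | t dvd fact P. of_nat d * of_int (moebius t) * wintner_partial (d * t) F (d * x))
      - ?f d) \<longlonglongrightarrow> (\<Sum>t | t dvd fact P. of_nat d * of_int (moebius t) * Win (d * t) F) - ?f d"
    by (intro tendsto_intros lim) auto
  then have "(\<lambda>x. \<Sum>r | r \<in> sifted P \<and> 1 < r \<and> r \<le> x. ?f (d * r) / of_nat r) \<longlonglongrightarrow>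
      (\<Sum>t | t dvd fact P. of_nat d * of_int (moebius t) * Win (d * t) F) - ?f d"
    by (rule Lim_transform_eventually)
      (use partial in \<open>auto intro!: eventually_sequentiallyI[of 1]\<close>)
  then show ?thesis
    unfolding Irr_def by (rule limI)
qed

section \<open>Passage to the limit and the finite expansion\<close>

lemma primes_at_top_nontrivial: "primes_at_top \<noteq> bot"
proof
  assume "primes_at_top = bot"
  then have "eventually (\<lambda>p. \<not> prime p) (at_top :: nat filter)"
    by (simp add: primes_at_top_def trivial_limit_def eventually_inf_principal)
  then obtain n :: nat where "\<forall>p\<ge>n. \<not> prime p"
    by (auto simp: eventually_at_top_linorder)
  then show False
    using bigger_prime[of n] by auto
qed

theorem theorem3:
  fixes F :: "nat \<Rightarrow> complex"
  assumes "\<forall>q\<ge>1. Win_exists q F"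
    and "\<forall>d\<ge>1. ((\<lambda>P. Irr P d F) \<longlongrightarrow> 0) primes_at_top"
    and "finite {q. q \<ge> 1 \<and> Win q F \<noteq> 0}"
  shows "\<exists>Q\<ge>1. \<forall>a\<ge>1. F a = (\<Sum>q=1..Q. Win q F * ramanujan_sum q a)"
proof -
  obtain B where B: "\<forall>q \<in> {q. q \<ge> 1 \<and> Win q F \<noteq> 0}. q \<le> B"
    using assms(3) finite_nat_set_iff_bounded_le by metis
  \<comment> \<open>The maximum with 1 guarantees Q >= 1 even when no Wintner coefficient is
    nonzero.\<close>
  define Q where "Q = max 1 B"
  have Win0: "Win q F = 0" if "q > Q" for q
  proof (rule ccontr)
    assume "Win q F \<noteq> 0"
    then have "q \<le> B"
      using B that by (simp add: Q_def)
    then show False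
      using that by (simp add: Q_def)
  qed
  have era: "eratosthenes F d =
      (\<Sum>q=1..Q. if d dvd q then of_nat d * of_int (moebius (q div d)) * Win q F else 0)"
    (is "_ = ?S") if d: "d \<ge> 1" for d
  proof -
    \<comment> \<open>Independence of P: substituting q = d * t, every t with d * t <= Q satisfies t
      <= P and hence divides P!. Any other divisor t of P! has d * t > Q, so its Wintner coefficient
      is zero.\<close>
    have sum_eq: "(\<Sum>t | t dvd fact P. of_nat d * of_int (moebius t) * Win (d * t) F) = ?S"
      if P: "P \<ge> Q" for P
    proof -
      have "?S = (\<Sum>q | q \<in> {1..Q} \<and> d dvd q. of_nat d * of_int (moebius (q div d)) * Win q F)"
        by (simp add: sum.If_cases Int_def)
      also have "\<dots> = (\<Sum>t | t \<ge> 1 \<and> d * t \<le> Q. of_nat d * of_int (moebius t) * Win (d * t) F)"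
        using d by (intro sum.reindex_bij_witness[of _ "\<lambda>t. d * t" "\<lambda>q. q div d"])
          (auto elim!: dvdE)
      also have "\<dots> = (\<Sum>t | t dvd fact P. of_nat d * of_int (moebius t) * Win (d * t) F)"
      proof (intro sum.mono_neutral_left subsetI)
        fix t assume t: "t \<in> {t. t \<ge> 1 \<and> d * t \<le> Q}"
        have "t \<le> d * t"
          using d by simp
        also have "\<dots> \<le> P"
          using t P by simp
        finally have "t \<le> P" .
        then show "t \<in> {t. t dvd fact P}"
          using t by (simp add: dvd_fact)
      next
        show "\<forall>t\<in>{t. t dvd fact P} - {t. t \<ge> 1 \<and> d * t \<le> Q}.
            of_nat d * of_int (moebius t) * Win (d * t) F = 0"
        proof
          fix t assume t: "t \<in> {t. t dvd fact P} - {t. t \<ge> 1 \<and> d * t \<le> Q}"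
          then have "t \<noteq> 0"
            by (auto intro: Nat.gr0I)
          then have "d * t > Q"
            using t by auto
          then show "of_nat d * of_int (moebius t) * Win (d * t) F = 0"
            by (simp add: Win0)
        qed
      qed auto
      finally show ?thesis by simp
    qed
    \<comment> \<open>Thus \<open>Irr P d F\<close> is constant in P from Q on, and its limit 0
      along the primes must be that constant. Uniqueness of this limit rests on the infinitude of
      primes.\<close>
    have "eventually (\<lambda>P. Irr P d F = ?S - eratosthenes F d) at_top"
      using Irr_eq_Win_sum[OF assms(1) d] sum_eq
      by (auto simp: eventually_at_top_linorder intro!: exI[of _ Q])
    then have "eventually (\<lambda>P. Irr P d F = ?S - eratosthenes F d) primes_at_top"
      unfolding primes_at_top_def by (rule filter_leD[OF inf_le1])
    then have "((\<lambda>P. Irr P d F) \<longlongrightarrow> ?S - eratosthenes F d) primes_at_top"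
      by (rule tendsto_eventually)
    then have "?S - eratosthenes F d = 0"
      using tendsto_unique[OF primes_at_top_nontrivial] assms(2) d by blast
    then show ?thesis by simp
  qed
  have "F a = (\<Sum>q=1..Q. Win q F * ramanujan_sum q a)" if a: "a \<ge> 1" for a
  proof -
    have "F a = (\<Sum>d | d dvd a. eratosthenes F d)"
      using a by (simp add: sum_eratosthenes_divisors)
    also have "\<dots> = (\<Sum>d | d dvd a. \<Sum>q=1..Q.
        if d dvd q then of_nat d * of_int (moebius (q div d)) * Win q F else 0)"
      using a by (intro sum.cong refl era) (auto intro: Nat.gr0I simp: Suc_le_eq)
    also have "\<dots> = (\<Sum>q=1..Q. \<Sum>d | d dvd a.
        if d dvd q then of_nat d * of_int (moebius (q div d)) * Win q F else 0)"
      by (rule sum.swap)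
    also have "\<dots> = (\<Sum>q=1..Q. Win q F * ramanujan_sum q a)"
    proof (intro sum.cong refl)
      fix q assume q: "q \<in> {1..Q}"
      \<comment> \<open>The inner sum ranges over common divisors of a and q: it filters the
        divisors of a by q, while Kluyver's formula filters those of q by a.\<close>
      have "{d. d dvd a} \<inter> {d. d dvd q} = {d. d dvd q} \<inter> {d. d dvd a}"
        by auto
      then show "(\<Sum>d | d dvd a.
          if d dvd q then of_nat d * of_int (moebius (q div d)) * Win q F else 0) =
          Win q F * ramanujan_sum q a"
        using a q
        by (simp add: ramanujan_sum_kluyver sum.If_cases sum_distrib_left mult_ac)
    qed
    finally show ?thesis .
  qed
  then show ?thesis
    by (intro exI[of _ Q]) (simp add: Q_def)
qed

end
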